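(* For any continuous nonnegative function $f:[0,1]\to\mathbb{R}$ and any integer $m\geq 0$, there exists a unique nonnegative polynomial $p\in\mathcal{P}^{m,+}$ minimizing $\|f-p\|_{L^2}$ over $\mathcal{P}^{m,+}$.
   Context: $\mathcal{P}^m$ denotes the space of real univariate polynomials of degree at most $m$, and $\mathcal{P}^{m,+}=\{p\in\mathcal{P}^m : p(x)\geq 0 \text{ for all } x\in[0,1]\}$. The norm is $\|g\|_{L^2}=\left(\int_0^1 g(x)^2\,dx\right)^{1/2}$. *)

theory Defs
  imports "HOL-Analysis.Analysis" "HOL-Computational_Algebra.Polynomial"
begin

definition poly_space :: "nat \<Rightarrow> real poly set" where
  "poly_space m = {p. degree p \<le> m}"

definition nonneg_poly_space :: "nat \<Rightarrow> real poly set" where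
  "nonneg_poly_space m = {p \<in> poly_space m. \<forall>x\<in>{0..1}. 0 \<le> poly p x}"

(* Henstock-Kurzweil integral: it is 0 when the square of g is not integrable on [0,1],
   so this is the norm only for g with an integrable square, e.g. g continuous on [0,1]. *)
definition L2_norm_01 :: "(real \<Rightarrow> real) \<Rightarrow> real" where
  "L2_norm_01 g = sqrt (integral {0..1} (\<lambda>x. (g x)\<^sup>2))"

end

theory Submission
  imports Defs
begin

text \<open>
  Existence is a compactness argument in coefficient space. Polynomials of degree at most
  \<open>m\<close> are encoded by coefficient sequences \<open>nat \<Rightarrow> real\<close> with the product topology, in which
  boxes supported on \<open>{..m}\<close> are compact (Tychonoff) and the squared \<open>L\<^sup>2\<close> distance to \<open>f\<close> is
  continuous, being a quadratic polynomial in the coefficients. Since \<open>\<parallel>p\<parallel>\<^sup>2\<close> is positive on the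
  compact unit sphere of coefficient vectors, it dominates a multiple of the sum of the squared
  coefficients (\<open>L2_norm_sq_coercive\<close>). Hence every \<open>p\<close> at least as close to \<open>f\<close> as the zero
  polynomial has coefficients in a fixed box, and the distance attains its minimum over the
  closed set of nonnegative polynomials in that box.

  Uniqueness follows from strict convexity: by the parallelogram identity the midpoint of two
  minimizers, which is again nonnegative, would be closer to \<open>f\<close> by \<open>\<parallel>p - q\<parallel>\<^sup>2 / 4\<close> in squared
  distance. Thus \<open>p\<close> and \<open>q\<close> agree on the infinite set \<open>[0,1]\<close>, so they are equal.
\<close>

section \<open>Squared norms and polynomials given by coefficients\<close>

lemma L2_norm_01_le_iff:
  "L2_norm_01 g \<le> L2_norm_01 h \<longleftrightarrow>
    integral {0..1} (\<lambda>x. (g x)\<^sup>2) \<le> integral {0..1} (\<lambda>x. (h x)\<^sup>2)"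
  by (simp add: L2_norm_01_def)

lemma poly_eq_if_eq_on_unit_interval:
  fixes p q :: "real poly"
  assumes "\<And>x. x \<in> {0..1} \<Longrightarrow> poly p x = poly q x"
  shows "p = q"
proof (rule ccontr)
  assume "p \<noteq> q"
  then have "finite {x. poly (p - q) x = 0}"
    by (intro poly_roots_finite) simp
  moreover have "{0..1} \<subseteq> {x. poly (p - q) x = 0}"
    using assms by auto
  ultimately have "finite {0..1::real}"
    by (rule finite_subset[rotated])
  then show False
    by (simp add: infinite_Icc)
qed

lemma poly_sum_monom: "poly (\<Sum>i\<le>m. monom (c i) i) x = (\<Sum>i\<le>m. c i * x ^ i)"
  for x :: real
  by (simp add: poly_sum poly_monom)

lemma poly_eq_sum_coeff:
  fixes p :: "real poly"
  assumes "degree p \<le> m"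
  shows "poly p x = (\<Sum>i\<le>m. coeff p i * x ^ i)"
  using poly_sum_monom[of "coeff p" m x] by (simp only: poly_as_sum_of_monoms'[OF assms])

lemma sum_monom_in_poly_space: "(\<Sum>i\<le>m. monom (c i) i) \<in> poly_space m"
  unfolding poly_space_def mem_Collect_eq
proof (rule degree_sum_le)
  show "degree (monom (c i) i) \<le> m" if "i \<in> {..m}" for i
    using that degree_monom_le[of "c i" i] by simp
qed simp

section \<open>Continuity and compactness in coefficient space\<close>

lemma continuous_on_coordinate [continuous_intros]:
  "continuous_on S (\<lambda>c::nat \<Rightarrow> real. c i)"
  by (rule continuous_on_subset[OF continuous_on_product_coordinates]) simp

lemma compact_coefficient_box:
  fixes R :: real and m :: nat
  shows "compact (\<Pi>\<^sub>E i\<in>UNIV. if i \<le> m then {-R..R} else {0})"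
proof -
  have "compactin (product_topology (\<lambda>i. euclidean) UNIV)
          (\<Pi>\<^sub>E i\<in>UNIV. if i \<le> m then {-R..R} else {0})"
    unfolding compactin_PiE by auto
  then show ?thesis
    by (simp add: euclidean_product_topology)
qed

lemma continuous_on_L2_dist_sq:
  fixes f :: "real \<Rightarrow> real"
  assumes f: "continuous_on {0..1} f"
  shows "continuous_on S (\<lambda>c. integral {0..1} (\<lambda>x. (f x - (\<Sum>i\<le>m. c i * x ^ i))\<^sup>2))"
proof -
  have int: "g integrable_on {0..1}" if "continuous_on {0..1} g" for g :: "real \<Rightarrow> real"
    using that by (rule integrable_continuous_real)
  have int_sq: "(\<lambda>x. (f x)\<^sup>2) integrable_on {0..1}"
    and int_fx: "(\<lambda>x. a * (f x * x ^ i)) integrable_on {0..1}"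
    and int_xx: "(\<lambda>x. a * (x ^ i * x ^ j)) integrable_on {0..1}"
    for a :: real and i j
    by (intro int continuous_intros f)+
  have int_lin: "(\<lambda>x. \<Sum>i\<le>m. 2 * c i * (f x * x ^ i)) integrable_on {0..1}"
    and int_quad: "(\<lambda>x. \<Sum>i\<le>m. \<Sum>j\<le>m. c i * c j * (x ^ i * x ^ j)) integrable_on {0..1}"
    for c :: "nat \<Rightarrow> real"
    by (intro int continuous_intros f)+
  have expand: "integral {0..1} (\<lambda>x. (f x - (\<Sum>i\<le>m. c i * x ^ i))\<^sup>2) =
      integral {0..1} (\<lambda>x. (f x)\<^sup>2)
      - (\<Sum>i\<le>m. 2 * c i * integral {0..1} (\<lambda>x. f x * x ^ i))
      + (\<Sum>i\<le>m. \<Sum>j\<le>m. c i * c j * integral {0..1} (\<lambda>x. x ^ i * x ^ j))" for c :: "nat \<Rightarrow> real"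
  proof -
    have "(f x - (\<Sum>i\<le>m. c i * x ^ i))\<^sup>2 = (f x)\<^sup>2 - (\<Sum>i\<le>m. 2 * c i * (f x * x ^ i))
        + (\<Sum>i\<le>m. \<Sum>j\<le>m. c i * c j * (x ^ i * x ^ j))" for x
    proof -
      have "(\<Sum>i\<le>m. c i * x ^ i)\<^sup>2 = (\<Sum>i\<le>m. \<Sum>j\<le>m. c i * c j * (x ^ i * x ^ j))"
        unfolding power2_eq_square sum_product by (simp add: mult_ac)
      moreover have "2 * f x * (\<Sum>i\<le>m. c i * x ^ i) = (\<Sum>i\<le>m. 2 * c i * (f x * x ^ i))"
        unfolding sum_distrib_left by (simp add: mult_ac)
      ultimately show ?thesis
        by (simp add: power2_diff)
    qed
    moreover have "integral {0..1} (\<lambda>x. (f x)\<^sup>2 - (\<Sum>i\<le>m. 2 * c i * (f x * x ^ i))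
        + (\<Sum>i\<le>m. \<Sum>j\<le>m. c i * c j * (x ^ i * x ^ j))) =
      integral {0..1} (\<lambda>x. (f x)\<^sup>2)
      - integral {0..1} (\<lambda>x. \<Sum>i\<le>m. 2 * c i * (f x * x ^ i))
      + integral {0..1} (\<lambda>x. \<Sum>i\<le>m. \<Sum>j\<le>m. c i * c j * (x ^ i * x ^ j))"
      by (simp add: integral_add integral_diff integrable_diff int_sq int_lin int_quad)
    moreover have "integral {0..1} (\<lambda>x. \<Sum>i\<le>m. 2 * c i * (f x * x ^ i)) =
        (\<Sum>i\<le>m. 2 * c i * integral {0..1} (\<lambda>x. f x * x ^ i))"
      by (simp add: integral_sum int_fx)
    moreover have "integral {0..1} (\<lambda>x. \<Sum>i\<le>m. \<Sum>j\<le>m. c i * c j * (x ^ i * x ^ j)) =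
        (\<Sum>i\<le>m. integral {0..1} (\<lambda>x. \<Sum>j\<le>m. c i * c j * (x ^ i * x ^ j)))"
      by (simp add: integral_sum integrable_sum int_xx)
    moreover have "integral {0..1} (\<lambda>x. \<Sum>j\<le>m. c i * c j * (x ^ i * x ^ j)) =
        (\<Sum>j\<le>m. c i * c j * integral {0..1} (\<lambda>x. x ^ i * x ^ j))" for i
      by (simp add: integral_sum int_xx)
    ultimately show ?thesis
      by simp
  qed
  show ?thesis
    unfolding expand
    by (intro continuous_on_add continuous_on_diff continuous_on_sum continuous_on_mult
        continuous_on_const continuous_on_coordinate)
qed

text \<open>All norms on the space of polynomials of degree at most \<open>m\<close> are equivalent; this is the
  half that bounds the coefficients by the \<open>L\<^sup>2\<close> norm.\<close>

lemma L2_norm_sq_coercive: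
  "\<exists>\<delta>>0. \<forall>c::nat \<Rightarrow> real.
    \<delta> * (\<Sum>i\<le>m. (c i)\<^sup>2) \<le> integral {0..1} (\<lambda>x. (\<Sum>i\<le>m. c i * x ^ i)\<^sup>2)"
proof -
  let ?N = "\<lambda>c::nat \<Rightarrow> real. integral {0..1} (\<lambda>x. (\<Sum>i\<le>m. c i * x ^ i)\<^sup>2)"
  let ?B = "\<Pi>\<^sub>E i\<in>UNIV. if i \<le> m then {-1..1::real} else {0}"
  let ?S = "?B \<inter> {c. (\<Sum>i\<le>m. (c i)\<^sup>2) = 1}"
  have "closed {c::nat \<Rightarrow> real. (\<Sum>i\<le>m. (c i)\<^sup>2) = 1}"
    by (intro closed_Collect_eq continuous_intros)
  then have compact: "compact ?S"
    using compact_coefficient_box by blast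
  have "(\<lambda>i. if i = 0 then 1 else 0) \<in> ?S"
    by (auto simp: if_distrib[of "\<lambda>t. t\<^sup>2"] cong: if_cong)
  then have nonempty: "?S \<noteq> {}"
    by blast
  have cont: "continuous_on ?S ?N"
    using continuous_on_L2_dist_sq[of "\<lambda>_. 0" ?S m] by simp
  obtain c0 where c0: "c0 \<in> ?S" and min: "\<And>c. c \<in> ?S \<Longrightarrow> ?N c0 \<le> ?N c"
    using continuous_attains_inf[OF compact nonempty cont] by auto
  have nonneg: "?N c \<ge> 0" for c
    by (intro Henstock_Kurzweil_Integration.integral_nonneg integrable_continuous_real
        continuous_intros) auto
  have "?N c0 \<noteq> 0"
  proof
    assume "?N c0 = 0"
    then have "\<forall>x\<in>{0..1}. (\<Sum>i\<le>m. c0 i * x ^ i)\<^sup>2 = 0"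
      by (subst (asm) integral_eq_0_iff) (auto intro!: continuous_intros)
    then have "(\<Sum>i\<le>m. monom (c0 i) i) = 0"
      by (intro poly_eq_if_eq_on_unit_interval) (simp add: poly_sum_monom)
    then have "coeff (\<Sum>i\<le>m. monom (c0 i) i) j = 0" for j
      by simp
    then have "c0 j = 0" if "j \<le> m" for j
      using that by (simp add: coeff_sum coeff_monom) (metis (no_types))
    with c0 show False
      by simp
  qed
  with nonneg[of c0] have pos: "?N c0 > 0"
    by simp
  have le: "?N c0 * (\<Sum>i\<le>m. (c i)\<^sup>2) \<le> ?N c" for c
  proof (cases "(\<Sum>i\<le>m. (c i)\<^sup>2) = 0")
    case True
    then show ?thesis
      using nonneg[of c] by simp
  next
    case False
    define s where "s = (\<Sum>i\<le>m. (c i)\<^sup>2)"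
    have s: "s > 0"
      using False sum_nonneg[of "{..m}" "\<lambda>i. (c i)\<^sup>2"] unfolding s_def by auto
    \<comment> \<open>Normalize \<open>c\<close>; entries beyond \<open>m\<close> do not affect the polynomial but must vanish in \<open>?S\<close>.\<close>
    define d where "d i = (if i \<le> m then c i / sqrt s else 0)" for i
    have "(\<Sum>i\<le>m. (d i)\<^sup>2) = (\<Sum>i\<le>m. (c i)\<^sup>2 / s)"
      using s by (intro sum.cong) (auto simp: d_def power_divide)
    also have "\<dots> = 1"
      using s by (simp add: s_def flip: sum_divide_distrib)
    finally have d1: "(\<Sum>i\<le>m. (d i)\<^sup>2) = 1" .
    have "\<bar>d i\<bar> \<le> 1" if "i \<le> m" for i
    proof -
      have "(d i)\<^sup>2 \<le> (\<Sum>i\<le>m. (d i)\<^sup>2)"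
        using that by (intro member_le_sum) auto
      then show ?thesis
        using d1 by (simp add: abs_square_le_1)
    qed
    moreover have "d i = 0" if "\<not> i \<le> m" for i
      using that by (simp add: d_def)
    ultimately have "d \<in> ?S"
      using d1 by (auto simp: abs_le_iff minus_le_iff)
    then have "?N c0 \<le> ?N d"
      by (rule min)
    also have "?N d = integral {0..1} (\<lambda>x. (1 / s) * (\<Sum>i\<le>m. c i * x ^ i)\<^sup>2)"
    proof -
      have "(\<Sum>i\<le>m. d i * x ^ i) = (\<Sum>i\<le>m. c i * x ^ i) / sqrt s" for x
        unfolding sum_divide_distrib by (intro sum.cong) (auto simp: d_def)
      then show ?thesis
        using s by (simp add: power_divide)
    qed
    also have "\<dots> = ?N c / s"
      by (subst integral_mult_right) simp
    finally show ?thesis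
      using s by (simp add: s_def field_simps)
  qed
  show ?thesis
    by (intro exI[of _ "?N c0"] conjI allI pos le)
qed

section \<open>Existence\<close>

lemma nonneg_L2_minimizer_exists:
  fixes f :: "real \<Rightarrow> real"
  assumes f: "continuous_on {0..1} f"
  shows "\<exists>p\<in>nonneg_poly_space m. \<forall>q\<in>nonneg_poly_space m.
    integral {0..1} (\<lambda>x. (f x - poly p x)\<^sup>2) \<le> integral {0..1} (\<lambda>x. (f x - poly q x)\<^sup>2)"
proof -
  define D where "D c = integral {0..1} (\<lambda>x. (f x - (\<Sum>i\<le>m. c i * x ^ i))\<^sup>2)"
    for c :: "nat \<Rightarrow> real"
  define A where "A = integral {0..1} (\<lambda>x. (f x)\<^sup>2)"
  obtain \<delta> :: real where \<delta>: "\<delta> > 0"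
    "\<And>c. \<delta> * (\<Sum>i\<le>m. (c i)\<^sup>2) \<le> integral {0..1} (\<lambda>x. (\<Sum>i\<le>m. c i * x ^ i)\<^sup>2)"
    using L2_norm_sq_coercive[of m] by auto
  have "A \<ge> 0"
    unfolding A_def by (intro Henstock_Kurzweil_Integration.integral_nonneg
        integrable_continuous_real continuous_intros f) auto
  have "D (\<lambda>_. 0) = A"
    by (simp add: D_def A_def)
  define R where "R = sqrt (4 * A / \<delta>)"
  let ?B = "\<Pi>\<^sub>E i\<in>UNIV. if i \<le> m then {-R..R} else {0}"
  define K where "K = ?B \<inter> {c. \<forall>x\<in>{0..1}. 0 \<le> (\<Sum>i\<le>m. c i * x ^ i)}"
  \<comment> \<open>From \<open>p\<^sup>2 \<le> 2 f\<^sup>2 + 2 (f - p)\<^sup>2\<close>, a competitor of the zero polynomial has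
    \<open>\<parallel>p\<parallel>\<^sup>2 \<le> 4 \<parallel>f\<parallel>\<^sup>2\<close>; this is where \<open>R\<close> comes from.\<close>
  have bound: "\<bar>c i\<bar> \<le> R" if "D c \<le> A" "i \<le> m" for c i
  proof -
    have "\<delta> * (c i)\<^sup>2 \<le> \<delta> * (\<Sum>i\<le>m. (c i)\<^sup>2)"
      using that(2) \<delta>(1) by (intro mult_left_mono member_le_sum) auto
    also have "\<dots> \<le> integral {0..1} (\<lambda>x. (\<Sum>i\<le>m. c i * x ^ i)\<^sup>2)"
      by (rule \<delta>(2))
    also have "\<dots> \<le> integral {0..1} (\<lambda>x. 2 * (f x)\<^sup>2 + 2 * (f x - (\<Sum>i\<le>m. c i * x ^ i))\<^sup>2)"
    proof (intro integral_le integrable_continuous_real continuous_intros f)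
      fix x :: real
      have "p\<^sup>2 \<le> 2 * a\<^sup>2 + 2 * (a - p)\<^sup>2" for a p :: real
        using zero_le_power2[of "2 * a - p"] by (simp add: power2_eq_square algebra_simps)
      then show "(\<Sum>i\<le>m. c i * x ^ i)\<^sup>2 \<le> 2 * (f x)\<^sup>2 + 2 * (f x - (\<Sum>i\<le>m. c i * x ^ i))\<^sup>2" .
    qed
    also have "\<dots> = 2 * A + 2 * D c"
      unfolding A_def D_def
      by (subst integral_add; (intro integrable_continuous_real continuous_intros f)?) simp
    also have "\<dots> \<le> 4 * A"
      using that by simp
    finally have "(c i)\<^sup>2 \<le> 4 * A / \<delta>"
      using \<delta>(1) by (simp add: field_simps)
    then show ?thesis
      unfolding R_def using real_sqrt_le_mono by fastforce
  qed
  have "closed {c::nat \<Rightarrow> real. \<forall>x\<in>{0..1}. 0 \<le> (\<Sum>i\<le>m. c i * x ^ i)}"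
    unfolding Ball_def
    by (intro closed_Collect_all closed_Collect_imp closed_Collect_le continuous_intros) simp
  then have compact: "compact K"
    unfolding K_def using compact_coefficient_box by blast
  have zero: "(\<lambda>_. 0) \<in> K"
    using \<open>A \<ge> 0\<close> \<delta>(1) by (auto simp: K_def R_def)
  then have nonempty: "K \<noteq> {}"
    by blast
  have cont: "continuous_on K D"
    unfolding D_def by (rule continuous_on_L2_dist_sq[OF f])
  obtain c0 where c0: "c0 \<in> K" and min: "\<And>c. c \<in> K \<Longrightarrow> D c0 \<le> D c"
    using continuous_attains_inf[OF compact nonempty cont] by auto
  show ?thesis
  proof (intro bexI ballI)
    let ?p = "\<Sum>i\<le>m. monom (c0 i) i"
    show "?p \<in> nonneg_poly_space m"
      using c0 sum_monom_in_poly_space by (auto simp: nonneg_poly_space_def K_def poly_sum_monom)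
    fix q assume q: "q \<in> nonneg_poly_space m"
    then have deg: "degree q \<le> m"
      by (simp add: nonneg_poly_space_def poly_space_def)
    have "D c0 \<le> D (coeff q)"
    proof (cases "D (coeff q) \<le> A")
      case True
      have "coeff q i = 0" if "\<not> i \<le> m" for i
        using that deg by (simp add: coeff_eq_0)
      moreover have "\<bar>coeff q i\<bar> \<le> R" if "i \<le> m" for i
        using bound[OF True that] .
      moreover have "0 \<le> (\<Sum>i\<le>m. coeff q i * x ^ i)" if "x \<in> {0..1}" for x
        using q that by (simp add: nonneg_poly_space_def flip: poly_eq_sum_coeff[OF deg])
      ultimately have "coeff q \<in> K"
        by (auto simp: K_def abs_le_iff minus_le_iff)
      then show ?thesis
        by (rule min)
    next
      case False
      then show ?thesis
        using min[OF zero] \<open>D (\<lambda>_. 0) = A\<close> by simp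
    qed
    then show "integral {0..1} (\<lambda>x. (f x - poly ?p x)\<^sup>2) \<le> integral {0..1} (\<lambda>x. (f x - poly q x)\<^sup>2)"
      by (simp add: D_def poly_sum_monom flip: poly_eq_sum_coeff[OF deg])
  qed
qed

section \<open>Uniqueness and conclusion\<close>

lemma midpoint_in_nonneg_poly_space:
  assumes "p \<in> nonneg_poly_space m" "q \<in> nonneg_poly_space m"
  shows "smult (1/2) (p + q) \<in> nonneg_poly_space m"
  using assms by (auto simp: nonneg_poly_space_def poly_space_def
      intro!: order.trans[OF degree_smult_le] degree_add_le)

lemma nonneg_L2_minimizer_unique:
  fixes f :: "real \<Rightarrow> real"
  assumes f: "continuous_on {0..1} f"
    and p: "p \<in> nonneg_poly_space m" and q: "q \<in> nonneg_poly_space m"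
    and p_min: "\<And>r. r \<in> nonneg_poly_space m \<Longrightarrow>
      integral {0..1} (\<lambda>x. (f x - poly p x)\<^sup>2) \<le> integral {0..1} (\<lambda>x. (f x - poly r x)\<^sup>2)"
    and q_min: "\<And>r. r \<in> nonneg_poly_space m \<Longrightarrow>
      integral {0..1} (\<lambda>x. (f x - poly q x)\<^sup>2) \<le> integral {0..1} (\<lambda>x. (f x - poly r x)\<^sup>2)"
  shows "p = q"
proof -
  let ?r = "smult (1/2) (p + q)"
  let ?D = "\<lambda>g. integral {0..1} (\<lambda>x. (f x - poly g x)\<^sup>2)"
  let ?E = "integral {0..1} (\<lambda>x. (poly p x - poly q x)\<^sup>2)"
  \<comment> \<open>The parallelogram identity for \<open>f - p\<close> and \<open>f - q\<close>, pointwise; it is integrated below.\<close>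
  have "(f x - poly p x)\<^sup>2 + (f x - poly q x)\<^sup>2
      = 2 * (f x - poly ?r x)\<^sup>2 + (1/2) * (poly p x - poly q x)\<^sup>2" for x
    by (simp add: power2_eq_square field_simps)
  then have "integral {0..1} (\<lambda>x. (f x - poly p x)\<^sup>2 + (f x - poly q x)\<^sup>2)
      = integral {0..1} (\<lambda>x. 2 * (f x - poly ?r x)\<^sup>2 + (1/2) * (poly p x - poly q x)\<^sup>2)"
    by presburger
  moreover have "integral {0..1} (\<lambda>x. (f x - poly p x)\<^sup>2 + (f x - poly q x)\<^sup>2) = ?D p + ?D q"
    by (intro integral_add integrable_continuous_real continuous_intros f)
  moreover have "integral {0..1} (\<lambda>x. 2 * (f x - poly ?r x)\<^sup>2 + (1/2) * (poly p x - poly q x)\<^sup>2)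
      = integral {0..1} (\<lambda>x. 2 * (f x - poly ?r x)\<^sup>2)
        + integral {0..1} (\<lambda>x. (1/2) * (poly p x - poly q x)\<^sup>2)"
    by (intro integral_add integrable_continuous_real continuous_intros f)
  moreover have "integral {0..1} (\<lambda>x. 2 * (f x - poly ?r x)\<^sup>2) = 2 * ?D ?r"
    "integral {0..1} (\<lambda>x. (1/2) * (poly p x - poly q x)\<^sup>2) = (1/2) * ?E"
    by (rule integral_mult_right)+
  ultimately have "?D p + ?D q = 2 * ?D ?r + ?E / 2"
    by linarith
  moreover have "?D p \<le> ?D ?r" "?D q \<le> ?D ?r"
    using p_min q_min midpoint_in_nonneg_poly_space[OF p q] by blast+
  moreover have "?E \<ge> 0"
    by (intro Henstock_Kurzweil_Integration.integral_nonneg integrable_continuous_real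
        continuous_intros) auto
  ultimately have "?E = 0"
    by linarith
  then have "\<forall>x\<in>{0..1}. (poly p x - poly q x)\<^sup>2 = 0"
    by (subst (asm) integral_eq_0_iff) (auto intro!: continuous_intros)
  then show ?thesis
    by (intro poly_eq_if_eq_on_unit_interval) simp
qed

theorem theorem1:
  fixes f :: "real \<Rightarrow> real" and m :: nat
  assumes "continuous_on {0..1} f"
    and "\<forall>x\<in>{0..1}. 0 \<le> f x"
  shows "\<exists>!p. p \<in> nonneg_poly_space m \<and>
    (\<forall>q \<in> nonneg_poly_space m.
      L2_norm_01 (\<lambda>x. f x - poly p x) \<le> L2_norm_01 (\<lambda>x. f x - poly q x))"
  unfolding L2_norm_01_le_iff
proof (rule ex_ex1I, goal_cases)
  case 1
  show ?case
    using nonneg_L2_minimizer_exists[OF assms(1), of m] by auto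
next
  case (2 p q)
  then show ?case
    by (intro nonneg_L2_minimizer_unique[OF assms(1), of p m q]) simp_all
qed

end
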